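(* Let $k$ be an algebraically closed field of characteristic $0$ and let $R=k\langle x,y\rangle/(xy-yx-y^2)$. The complete set of primitive ideals in $R$ consists of the ideals $\mathrm{id}(y,x-\alpha)$, $\alpha\in k$.
   Context: $k\langle x,y\rangle$ is the free associative algebra on $x,y$ over $k$, and $(xy-yx-y^2)$ is its two-sided ideal generated by $xy-yx-y^2$. $\mathrm{id}(S)$ denotes the two-sided ideal of $R$ generated by the set $S$. A primitive ideal is the annihilator of a simple module.
   Formalization: Primitive ideals are taken as annihilators of finite-dimensional simple left modules (realized on sets of elements of R, no loss): unrestricted, the claim fails, since k[t] with x acting as t and y as (1+d/dt)^(-1) is simple and not annihilated by y. *)

theory Defs
  imports
    "HOL-Algebra.Algebra"
    "HOL-Algebra.Algebraic_Closure_Type"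
    "HOL-Library.Poly_Mapping"
begin

section \<open>The free associative algebra on two generators\<close>

text \<open>
  Words are the free monoid, written additively because the convolution product of
  \<^type>\<open>poly_mapping\<close> is taken over \<^class>\<open>monoid_add\<close>.  Hence
  finitely supported maps from words to a field form the free associative algebra.
\<close>

datatype 'a word = Word (letters: "'a list")

instantiation word :: (type) monoid_add
begin

definition zero_word :: "'a word" where
  "0 = Word []"

definition plus_word :: "'a word \<Rightarrow> 'a word \<Rightarrow> 'a word" where
  "u + v = Word (letters u @ letters v)"

instance
  by standard (simp_all add: zero_word_def plus_word_def)

end

datatype gen = GenX | GenY

type_synonym 'k free_alg = "gen word \<Rightarrow>\<^sub>0 'k"

definition free_gen :: "gen \<Rightarrow> 'k::field free_alg" where
  "free_gen g = Poly_Mapping.single (Word [g]) 1"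

definition free_const :: "'k::field \<Rightarrow> 'k free_alg" where
  "free_const \<alpha> = Poly_Mapping.single 0 \<alpha>"


section \<open>The Jordan plane\<close>

definition jordan_ideal :: "'k::field free_alg set" where
  "jordan_ideal =
     genideal ring_of_type_algebra
       {free_gen GenX * free_gen GenY - free_gen GenY * free_gen GenX
          - free_gen GenY * free_gen GenY}"

definition jordan_plane :: "'k::field free_alg set ring" where
  "jordan_plane = ring_of_type_algebra Quot jordan_ideal"

definition jordan_class :: "'k::field free_alg \<Rightarrow> 'k free_alg set" where
  "jordan_class f = jordan_ideal +>\<^bsub>ring_of_type_algebra\<^esub> f"

abbreviation jordan_x :: "'k::field free_alg set" where
  "jordan_x \<equiv> jordan_class (free_gen GenX)"

abbreviation jordan_y :: "'k::field free_alg set" where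
  "jordan_y \<equiv> jordan_class (free_gen GenY)"

abbreviation jordan_const :: "'k::field \<Rightarrow> 'k free_alg set" where
  "jordan_const \<alpha> \<equiv> jordan_class (free_const \<alpha>)"


section \<open>Simple modules and primitive ideals\<close>

text \<open>
  The library's locale of modules requires a commutative ring, so unital left modules over
  an arbitrary ring are introduced here.  The library's submodules carry no such restriction.
\<close>

locale left_module = R?: ring R + M?: abelian_group M
  for R :: "('r, 'c) ring_scheme" (structure) and M :: "('r, 'm) module" (structure) +
  assumes smult_closed:
      "\<lbrakk>a \<in> carrier R; m \<in> carrier M\<rbrakk> \<Longrightarrow> a \<odot>\<^bsub>M\<^esub> m \<in> carrier M"
    and smult_l_distr:
      "\<lbrakk>a \<in> carrier R; b \<in> carrier R; m \<in> carrier M\<rbrakk> \<Longrightarrow>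
        (a \<oplus>\<^bsub>R\<^esub> b) \<odot>\<^bsub>M\<^esub> m = a \<odot>\<^bsub>M\<^esub> m \<oplus>\<^bsub>M\<^esub> b \<odot>\<^bsub>M\<^esub> m"
    and smult_r_distr:
      "\<lbrakk>a \<in> carrier R; m \<in> carrier M; n \<in> carrier M\<rbrakk> \<Longrightarrow>
        a \<odot>\<^bsub>M\<^esub> (m \<oplus>\<^bsub>M\<^esub> n) = a \<odot>\<^bsub>M\<^esub> m \<oplus>\<^bsub>M\<^esub> a \<odot>\<^bsub>M\<^esub> n"
    and smult_assoc:
      "\<lbrakk>a \<in> carrier R; b \<in> carrier R; m \<in> carrier M\<rbrakk> \<Longrightarrow>
        (a \<otimes>\<^bsub>R\<^esub> b) \<odot>\<^bsub>M\<^esub> m = a \<odot>\<^bsub>M\<^esub> (b \<odot>\<^bsub>M\<^esub> m)"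
    and smult_one:
      "m \<in> carrier M \<Longrightarrow> \<one>\<^bsub>R\<^esub> \<odot>\<^bsub>M\<^esub> m = m"

definition simple_left_module ::
    "('r, 'c) ring_scheme \<Rightarrow> ('r, 'm) module \<Rightarrow> bool" where
  "simple_left_module R M \<longleftrightarrow>
     left_module R M \<and> carrier M \<noteq> {\<zero>\<^bsub>M\<^esub>} \<and>
     (\<forall>N. submodule N R M \<longrightarrow> N = {\<zero>\<^bsub>M\<^esub>} \<or> N = carrier M)"

definition module_annihilator ::
    "('r, 'c) ring_scheme \<Rightarrow> ('r, 'm) module \<Rightarrow> 'r set" where
  "module_annihilator R M =
     {r \<in> carrier R. \<forall>m \<in> carrier M. r \<odot>\<^bsub>M\<^esub> m = \<zero>\<^bsub>M\<^esub>}"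

text \<open>
  The scalars act on a module through the structure map \<open>\<iota>\<close> of the algebra.
\<close>

definition finite_dimensional_module ::
    "('k \<Rightarrow> 'r) \<Rightarrow> ('r, 'm) module \<Rightarrow> bool" where
  "finite_dimensional_module \<iota> M \<longleftrightarrow>
     (\<exists>B. finite B \<and> B \<subseteq> carrier M \<and>
       (\<forall>m \<in> carrier M. \<exists>c. m = finsum M (\<lambda>b. \<iota> (c b) \<odot>\<^bsub>M\<^esub> b) B))"

text \<open>
  The Jordan plane in characteristic 0 also has infinite-dimensional simple modules, for
  example \<open>k[t]\<close> with \<open>x\<close> acting as multiplication by \<open>t\<close> and \<open>y\<close> as the inverse of
  \<open>1 + d/dt\<close>, which is not annihilated by \<open>y\<close>.  Primitive ideals are therefore taken in the
  setting of finite-dimensional modules.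

  Letting the carrier of \<open>M\<close> range over sets of sets of ring elements loses nothing: every
  simple left module is isomorphic to a module of cosets of a maximal left ideal.
\<close>

definition fd_primitive_ideal ::
    "('k \<Rightarrow> 'r) \<Rightarrow> ('r, 'c) ring_scheme \<Rightarrow> 'r set \<Rightarrow> bool" where
  "fd_primitive_ideal \<iota> R P \<longleftrightarrow>
     (\<exists>M :: ('r, 'r set) module.
        simple_left_module R M \<and> finite_dimensional_module \<iota> M \<and>
        P = module_annihilator R M)"

end

theory Submission
  imports Defs
begin

text \<open>
  Write \<open>R\<close> for the Jordan plane, with \<open>xy - yx = y\<^sup>2\<close>, and let \<open>M\<close> be a finite-dimensional simple
  \<open>R\<close>-module.  The heart of the matter is that \<open>y\<close> is not injective on \<open>M\<close>
  (\<open>y_has_kernel\<close>).  As the field is algebraically closed, \<open>y\<close> has an eigenvector \<open>g\<close>, with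
  eigenvalue \<open>r\<close> say; suppose \<open>r \<noteq> 0\<close>.  The relation of \<open>R\<close> says formally that
  \<open>[y\<^sup>-\<^sup>1, x] = 1\<close>, so that on the vectors \<open>p(x)g\<close>, where \<open>p\<close> is a polynomial, \<open>y\<close> acts as
  the inverse of the operator \<open>1/r + d/dx\<close> on \<open>p\<close>.  That operator is onto because it is a nonzero
  scalar plus a locally nilpotent operator.  Take \<open>p\<close> nonzero of least degree with \<open>p(x)g = 0\<close>,
  and \<open>s\<close> with \<open>s/r + s' = p\<close>.  Then \<open>s(x)g = y p(x)g = 0\<close>, hence also \<open>s'(x)g = 0\<close>; but
  \<open>s\<close> has the degree of \<open>p\<close>, which is positive, and in characteristic 0 its derivative is a nonzero
  polynomial of smaller degree.  This contradicts the choice of \<open>p\<close>.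

  So the kernel of \<open>y\<close> is nonzero.  It is a submodule, because \<open>yx = (x - y)y\<close>, hence \<open>y\<close> acts as
  zero on \<open>M\<close>.  Then \<open>x\<close> commutes with all of \<open>R\<close> in its action on \<open>M\<close>, so its eigenspaces
  are submodules and \<open>x\<close> acts as a scalar \<open>\<alpha>\<close>.  The annihilator of \<open>M\<close> therefore contains
  \<open>id(y, x - \<alpha>)\<close>.  Every element of \<open>R\<close> is a scalar modulo this ideal
  (\<open>scalar_mod_point_ideal\<close>), so no proper ideal lies strictly above it
  (\<open>point_ideal_maximal\<close>) and the annihilator is equal to it.

  Conversely \<open>id(y, x - \<alpha>)\<close> is proper, since evaluation at \<open>x = \<alpha>\<close>, \<open>y = 0\<close> is a character of
  \<open>R\<close> that vanishes on it, and the quotient of \<open>R\<close> by it is a one-dimensional module with that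
  annihilator (\<open>point_ideal_fd_primitive\<close>).

  The computations with eigenvectors take place in the free algebra: a vector \<open>v\<close> of \<open>M\<close> is
  replaced by the left ideal \<open>L\<close> of all \<open>f\<close> with \<open>fv = 0\<close>, so that \<open>fv = 0\<close> becomes
  \<open>f \<in> L\<close>, and finite dimension of \<open>M\<close> becomes finite codimension of \<open>L\<close>.
\<close>

section \<open>Eigenvectors modulo left ideals of finite codimension\<close>

text \<open>
  Gaussian elimination: a vector whose coordinate at \<open>b\<close> is not zero serves to clear this
  coordinate in all the others, which leaves one vector and one coordinate less.
\<close>

lemma nontrivial_linear_relation:
  fixes c :: "'i \<Rightarrow> 'b \<Rightarrow> 'k::field"
  assumes "finite B" "finite I" "card B < card I"
  shows "\<exists>a. (\<exists>i\<in>I. a i \<noteq> 0) \<and> (\<forall>b\<in>B. (\<Sum>i\<in>I. a i * c i b) = 0)"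
  using assms
proof (induction B arbitrary: I c rule: finite_induct)
  case empty
  then have "I \<noteq> {}" by auto
  then show ?case by (intro exI[of _ "\<lambda>_. 1"]) auto
next
  case (insert b B)
  show ?case
  proof (cases "\<forall>i\<in>I. c i b = 0")
    case True
    have "card B < card I" using insert by simp
    from insert.IH[OF insert.prems(1) this, of c] True show ?thesis by auto
  next
    case False
    then obtain j where j: "j \<in> I" "c j b \<noteq> 0" by blast
    define J where "J = I - {j}"
    have J: "finite J" "j \<notin> J" "I = insert j J" using j insert.prems by (auto simp: J_def)
    have "card B < card J" using insert J by simp
    from insert.IH[OF J(1) this, of "\<lambda>i b'. c i b' - c i b / c j b * c j b'"]
    obtain a where a: "\<exists>i\<in>J. a i \<noteq> 0"
      "\<forall>b'\<in>B. (\<Sum>i\<in>J. a i * (c i b' - c i b / c j b * c j b')) = 0" by blast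
    define s where "s = (\<Sum>i\<in>J. a i * c i b) / c j b"
    define a' where "a' = a(j := - s)"
    have sum: "(\<Sum>i\<in>I. a' i * c i b') = (\<Sum>i\<in>J. a i * c i b') - s * c j b'" for b'
    proof -
      have "(\<Sum>i\<in>J. a' i * c i b') = (\<Sum>i\<in>J. a i * c i b')"
        using J by (intro sum.cong) (auto simp: a'_def)
      then show ?thesis using J by (simp add: a'_def)
    qed
    have rel: "(\<Sum>i\<in>J. a i * (c i b' - c i b / c j b * c j b')) =
          (\<Sum>i\<in>J. a i * c i b') - s * c j b'" for b'
      by (simp add: s_def right_diff_distrib sum_subtractf sum_divide_distrib sum_distrib_right
          mult.assoc)
    have "(\<Sum>i\<in>I. a' i * c i b') = 0" if "b' \<in> insert b B" for b'
    proof (cases "b' = b")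
      case True
      then show ?thesis using j by (simp add: sum) (simp add: s_def)
    next
      case False
      then show ?thesis using that a(2) by (simp only: sum rel) blast
    qed
    moreover have "\<exists>i\<in>I. a' i \<noteq> 0" using a(1) J by (auto simp: a'_def)
    ultimately show ?thesis by blast
  qed
qed

text \<open>
  The solution is the Neumann series \<open>r p - r\<^sup>2 p' + r\<^sup>3 p'' - \<dots>\<close>, which is finite since
  differentiation lowers the degree.
\<close>

lemma surj_smult_plus_pderiv:
  fixes p :: "'k::field_char_0 poly"
  assumes "r \<noteq> 0"
  shows "\<exists>s. smult (inverse r) s + pderiv s = p"
proof (induction "degree p" arbitrary: p rule: less_induct)
  case less
  show ?case
  proof (cases "degree p = 0")
    case True
    then have "pderiv p = 0" by (simp add: pderiv_eq_0_iff)
    then show ?thesis using assms by (intro exI[of _ "smult r p"]) (simp add: pderiv_smult)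
  next
    case False
    then have "degree (smult r (pderiv p)) < degree p" using assms by (simp add: degree_pderiv)
    from less[OF this] obtain t where "smult (inverse r) t + pderiv t = smult r (pderiv p)" by blast
    then show ?thesis using assms
      by (intro exI[of _ "smult r p - t"])
        (simp add: pderiv_diff pderiv_smult smult_diff_right algebra_simps)
  qed
qed

locale central_scalars =
  fixes \<iota> :: "'k::field \<Rightarrow> 'a::ring_1"
  assumes scalar_add: "\<iota> (a + b) = \<iota> a + \<iota> b"
    and scalar_mult: "\<iota> (a * b) = \<iota> a * \<iota> b"
    and scalar_1: "\<iota> 1 = 1"
    and scalar_central: "\<iota> a * f = f * \<iota> a"
begin

lemma scalar_0: "\<iota> 0 = 0"
  using scalar_add[of 0 0] by simp

lemma scalar_uminus: "\<iota> (- a) = - \<iota> a"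
  using scalar_add[of a "- a"] by (simp add: scalar_0 eq_neg_iff_add_eq_0 add.commute)

definition poly_at :: "'a \<Rightarrow> 'k poly \<Rightarrow> 'a" where
  "poly_at T p = fold_coeffs (\<lambda>a f. \<iota> a + T * f) p 0"

lemma poly_at_0 [simp]: "poly_at T 0 = 0"
  by (simp add: poly_at_def)

lemma poly_at_pCons [simp]: "poly_at T (pCons a p) = \<iota> a + T * poly_at T p"
  by (cases "a = 0 \<and> p = 0") (auto simp: poly_at_def scalar_0)

lemma poly_at_add: "poly_at T (p + q) = poly_at T p + poly_at T q"
  by (induction p q rule: poly_induct2) (simp_all add: scalar_add algebra_simps)

lemma poly_at_smult: "poly_at T (smult a p) = \<iota> a * poly_at T p"
proof (induction p)
  case (pCons b p)
  have "T * (\<iota> a * poly_at T p) = \<iota> a * (T * poly_at T p)"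
    by (metis mult.assoc scalar_central)
  with pCons show ?case by (simp add: scalar_mult distrib_left)
qed simp

lemma poly_at_sum: "poly_at T (sum p A) = (\<Sum>i\<in>A. poly_at T (p i))"
  by (induction A rule: infinite_finite_induct) (auto simp: poly_at_add)

lemma poly_at_monom: "poly_at T (monom a n) = \<iota> a * T ^ n"
proof (induction n)
  case (Suc n)
  have "T * (\<iota> a * T ^ n) = \<iota> a * (T * T ^ n)" by (metis mult.assoc scalar_central)
  with Suc show ?case by (simp add: monom_Suc scalar_0)
qed (simp add: monom_0)

lemma poly_at_linear_factor:
  "poly_at T ([:- r, 1:] * q) = (T - \<iota> r) * poly_at T q"
proof -
  have "[:- r, 1:] * q = smult (- r) q + pCons 0 q" by simp
  then show ?thesis
    by (simp only: poly_at_add poly_at_smult poly_at_pCons scalar_uminus scalar_0)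
      (simp add: left_diff_distrib)
qed

definition left_ideal :: "'a set \<Rightarrow> bool" where
  "left_ideal L \<longleftrightarrow> 0 \<in> L \<and> (\<forall>f\<in>L. \<forall>g\<in>L. f + g \<in> L) \<and> (\<forall>f\<in>L. \<forall>h. h * f \<in> L)"

text \<open>
  The quotient by \<open>L\<close> has dimension at most \<open>n\<close> when any \<open>n + 1\<close> elements are linearly dependent
  modulo \<open>L\<close>; in this form it yields annihilating polynomials at once.
\<close>

definition finite_codimension :: "'a set \<Rightarrow> bool" where
  "finite_codimension L \<longleftrightarrow>
     (\<exists>n. \<forall>f::nat \<Rightarrow> 'a. \<exists>a. (\<exists>i\<le>n. a i \<noteq> 0) \<and> (\<Sum>i\<le>n. \<iota> (a i) * f i) \<in> L)"

lemma left_ideal_mult: "left_ideal L \<Longrightarrow> f \<in> L \<Longrightarrow> h * f \<in> L"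
  and left_ideal_add: "left_ideal L \<Longrightarrow> f \<in> L \<Longrightarrow> g \<in> L \<Longrightarrow> f + g \<in> L"
  and left_ideal_0: "left_ideal L \<Longrightarrow> 0 \<in> L"
  by (auto simp: left_ideal_def)

lemma left_ideal_uminus: "left_ideal L \<Longrightarrow> f \<in> L \<Longrightarrow> - f \<in> L"
  using left_ideal_mult[of L f "-1"] by simp

lemma left_ideal_diff: "left_ideal L \<Longrightarrow> f \<in> L \<Longrightarrow> g \<in> L \<Longrightarrow> f - g \<in> L"
  using left_ideal_add[of L f "- g"] left_ideal_uminus by simp

text \<open>
  This is the minimal polynomial of \<open>T\<close> on the vector that \<open>g\<close> represents.  It exists because the
  elements \<open>T\<^sup>i g\<close> are dependent modulo \<open>L\<close>; it is not constant because \<open>g\<close> is not in \<open>L\<close>.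
\<close>

lemma least_annihilating_poly:
  assumes "left_ideal L" "finite_codimension L" "g \<notin> L"
  obtains p where "p \<noteq> 0" "poly_at T p * g \<in> L" "degree p > 0"
    "\<And>q. q \<noteq> 0 \<Longrightarrow> degree q < degree p \<Longrightarrow> poly_at T q * g \<notin> L"
proof -
  define P where "P p \<longleftrightarrow> p \<noteq> 0 \<and> poly_at T p * g \<in> L" for p
  obtain n a where a: "\<exists>i\<le>n. a i \<noteq> 0" "(\<Sum>i\<le>n. \<iota> (a i) * (T ^ i * g)) \<in> L"
    using assms(2) unfolding finite_codimension_def by meson
  define p0 where "p0 = (\<Sum>i\<le>n. monom (a i) i)"
  have "coeff p0 i = a i" if "i \<le> n" for i
    using that by (simp add: p0_def coeff_sum)
  then have "p0 \<noteq> 0" using a(1) by (metis coeff_0)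
  moreover have "poly_at T p0 * g = (\<Sum>i\<le>n. \<iota> (a i) * (T ^ i * g))"
    by (simp add: p0_def poly_at_sum poly_at_monom sum_distrib_right mult.assoc)
  ultimately have "P p0" using a(2) by (simp add: P_def)
  from ex_has_least_nat[of P, OF this, of degree]
  obtain p where p: "P p" "\<And>q. P q \<Longrightarrow> degree p \<le> degree q" by blast
  have "degree p \<noteq> 0"
  proof
    assume "degree p = 0"
    then obtain b where b: "p = [:b:]" by (auto elim: degree_eq_zeroE)
    then have "b \<noteq> 0" "\<iota> b * g \<in> L" using p(1) by (auto simp: P_def)
    then have "\<iota> (inverse b) * (\<iota> b * g) \<in> L" using left_ideal_mult assms(1) by blast
    moreover have "\<iota> (inverse b) * (\<iota> b * g) = g"
      using \<open>b \<noteq> 0\<close> by (simp flip: mult.assoc scalar_mult add: scalar_1)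
    ultimately show False using assms(3) by simp
  qed
  then show thesis using p by (intro that[of p]) (auto simp: P_def dest: leD)
qed

text \<open>
  Split a linear factor off the minimal polynomial: the cofactor does not kill the vector yet, and
  what it produces is an eigenvector.
\<close>

lemma eigenvector_exists:
  fixes T :: 'a
  assumes closed: "\<And>p::'k poly. degree p > 0 \<Longrightarrow> \<exists>r. poly p r = 0"
    and L: "left_ideal L" "finite_codimension L" "1 \<notin> L"
  shows "\<exists>g r. g \<notin> L \<and> (T - \<iota> r) * g \<in> L"
proof -
  obtain p where p: "p \<noteq> 0" "poly_at T p * 1 \<in> L" "degree p > 0"
    "\<And>q. q \<noteq> 0 \<Longrightarrow> degree q < degree p \<Longrightarrow> poly_at T q * 1 \<notin> L"
    using least_annihilating_poly[OF L] by metis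
  obtain r where "poly p r = 0" using closed[OF p(3)] by blast
  then obtain q where q: "p = [:- r, 1:] * q" by (metis poly_eq_0_iff_dvd dvdE)
  then have "q \<noteq> 0" "degree q < degree p"
    using p(1) by (auto simp: degree_mult_eq simp del: mult_pCons_left)
  then have "poly_at T q \<notin> L" using p(4) by fastforce
  moreover have "(T - \<iota> r) * poly_at T q \<in> L"
    using p(2) unfolding q poly_at_linear_factor by simp
  ultimately show ?thesis by blast
qed

text \<open>
  Modulo \<open>L\<close>, \<open>g\<close> is an eigenvector of \<open>y\<close>, and on the vectors \<open>p(x)g\<close> the action of \<open>y\<close>
  undoes \<open>p \<mapsto> p/r + p'\<close>.  On constants this is the eigenvalue equation.  The passage from \<open>p\<close> to
  \<open>a + x p\<close> rests on \<open>yx = xy - y\<^sup>2\<close> and the product rule \<open>(x p)' = p + x p'\<close>, whose extra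
  terms cancel.
\<close>

lemma y_inverts_scalar_plus_pderiv:
  assumes L: "left_ideal L"
    and rel: "\<And>f. (x * y - y * x - y * y) * f \<in> L"
    and eigen: "(y - \<iota> r) * g \<in> L" and r: "r \<noteq> 0"
  shows "y * poly_at x (smult (inverse r) p + pderiv p) * g - poly_at x p * g \<in> L"
proof (induction p)
  case 0
  show ?case using left_ideal_0[OF L] by simp
next
  case (pCons a p)
  define u where "u = poly_at x (smult (inverse r) p + pderiv p)"
  define v where "v = poly_at x p"
  have "\<iota> (inverse r * a) * ((y - \<iota> r) * g) =
      (\<iota> (inverse r * a) * y) * g - \<iota> (inverse r * a * r) * g"
    by (simp only: left_diff_distrib right_diff_distrib scalar_mult mult.assoc)
  also have "\<dots> = y * (\<iota> (inverse r * a) * g) - \<iota> a * g"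
    using r by (simp only: scalar_central[of _ y] mult.assoc[of y]) (simp add: field_simps)
  finally have 1: "y * (\<iota> (inverse r * a) * g) - \<iota> a * g \<in> L"
    using left_ideal_mult[OF L eigen] by metis
  have 2: "x * (y * u * g - v * g) \<in> L" "y * (y * u * g - v * g) \<in> L"
    using pCons left_ideal_mult[OF L] by (auto simp: u_def v_def)
  have "poly_at x (smult (inverse r) (pCons a p) + pderiv (pCons a p)) =
      \<iota> (inverse r * a) + x * u + v"
    by (simp add: u_def v_def pderiv_pCons poly_at_add scalar_0 algebra_simps)
  then have "y * poly_at x (smult (inverse r) (pCons a p) + pderiv (pCons a p)) * g
        - poly_at x (pCons a p) * g =
      (y * (\<iota> (inverse r * a) * g) - \<iota> a * g) + x * (y * u * g - v * g)
        - y * (y * u * g - v * g) - (x * y - y * x - y * y) * (u * g)"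
    by (simp add: v_def algebra_simps)
  also have "\<dots> \<in> L"
    by (intro left_ideal_add[OF L] left_ideal_diff[OF L] 1 2 rel)
  finally show ?case .
qed

end

text \<open>
  If an eigenvalue \<open>r\<close> of \<open>y\<close> were not zero, the ideal of all polynomials \<open>p\<close> with
  \<open>p(x)g \<in> L\<close> would be stable under the inverse of \<open>1/r + d/dx\<close>, and then a generator of it could
  be differentiated to give a nonzero member of smaller degree.
\<close>

lemma y_has_kernel:
  fixes \<iota> :: "'k::{alg_closed_field, field_char_0} \<Rightarrow> 'a::ring_1"
  assumes "central_scalars \<iota>"
    and L: "central_scalars.left_ideal L" "central_scalars.finite_codimension \<iota> L" "1 \<notin> L"
    and rel: "\<And>f. (x * y - y * x - y * y) * f \<in> L"
  shows "\<exists>g. g \<notin> L \<and> y * g \<in> L"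
proof -
  interpret central_scalars \<iota> by fact
  obtain g r where g: "g \<notin> L" "(y - \<iota> r) * g \<in> L"
    using eigenvector_exists[OF _ L] alg_closed_imp_poly_has_root by metis
  show ?thesis
  proof (cases "r = 0")
    case True
    then show ?thesis using g by (auto simp: scalar_0)
  next
    case False
    obtain p where p: "p \<noteq> 0" "poly_at x p * g \<in> L" "degree p > 0"
      "\<And>q. q \<noteq> 0 \<Longrightarrow> degree q < degree p \<Longrightarrow> poly_at x q * g \<notin> L"
      using least_annihilating_poly[OF L(1,2) g(1)] by metis
    \<comment> \<open>By the previous lemma \<open>y\<close> sends \<open>p(x)g\<close> to \<open>s(x)g\<close>, so \<open>s\<close> inherits annihilation
      from \<open>p\<close>, and so does \<open>s' = p - s/r\<close>.\<close>
    obtain s where s: "smult (inverse r) s + pderiv s = p"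
      using surj_smult_plus_pderiv[OF False] by blast
    then have "s \<noteq> 0" using p(1) by auto
    have "y * poly_at x p * g - poly_at x s * g \<in> L"
      using y_inverts_scalar_plus_pderiv[OF L(1) rel g(2) False, of s] s by simp
    moreover have "y * poly_at x p * g \<in> L"
      using left_ideal_mult[OF L(1) p(2)] by (simp add: mult.assoc)
    ultimately have sL: "poly_at x s * g \<in> L"
      using left_ideal_diff[OF L(1)] by fastforce
    have "poly_at x (pderiv s) * g = poly_at x p * g - \<iota> (inverse r) * (poly_at x s * g)"
      unfolding s[symmetric] by (simp add: poly_at_add poly_at_smult algebra_simps)
    then have dL: "poly_at x (pderiv s) * g \<in> L"
      using left_ideal_diff[OF L(1) p(2) left_ideal_mult[OF L(1) sL]] by simp
    have "degree p = degree s"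
    proof (cases "degree s = 0")
      case True
      then have "pderiv s = 0" by (simp add: pderiv_eq_0_iff)
      then show ?thesis using s False by auto
    next
      case d: False
      then have "degree (pderiv s) < degree (smult (inverse r) s)"
        using False by (simp add: degree_pderiv)
      from degree_add_eq_left[OF this] show ?thesis using s False by simp
    qed
    then have "pderiv s \<noteq> 0" "degree (pderiv s) < degree p"
      using p(3) by (auto simp: pderiv_eq_0_iff degree_pderiv)
    then show ?thesis using p(4) dL by blast
  qed
qed


section \<open>The free algebra\<close>

lemma free_alg_induct_single [case_names single add]:
  assumes single: "\<And>w a. P (Poly_Mapping.single w a)"
    and add: "\<And>f g. P f \<Longrightarrow> P g \<Longrightarrow> P (f + g)"
  shows "P (f :: 'k::field free_alg)"
proof (induction f rule: update_induct)
  case const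
  show ?case using single[of 0 0] by (simp only: single_zero)
next
  case (update f w a)
  then have "Poly_Mapping.update w a f = Poly_Mapping.single w a + f"
    by (intro poly_mapping_eqI) (auto simp: lookup_update lookup_add lookup_single in_keys_iff)
  then show ?case using single add update by simp
qed

text \<open>
  A property of all elements need only be checked along left multiplication by the two generators,
  since every word is built up from the empty one by adding letters on the left.
\<close>

lemma free_alg_induct [case_names const gen add]:
  assumes const: "\<And>a. P (free_const a)"
    and gen: "\<And>g f. P f \<Longrightarrow> P (free_gen g * f)"
    and add: "\<And>f g. P f \<Longrightarrow> P g \<Longrightarrow> P (f + g)"
  shows "P (f :: 'k::field free_alg)"
proof (induction f rule: free_alg_induct_single)
  case (single w a)
  have "P (Poly_Mapping.single (Word gs) a)" for gs
  proof (induction gs)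
    case Nil
    show ?case using const[of a] by (simp add: free_const_def zero_word_def)
  next
    case (Cons g gs)
    have "Poly_Mapping.single (Word (g # gs)) a = free_gen g * Poly_Mapping.single (Word gs) a"
      by (simp add: free_gen_def mult_single plus_word_def)
    then show ?case using gen[OF Cons] by simp
  qed
  from this[of "letters w"] show ?case by simp
qed (rule add)

interpretation free: central_scalars "free_const :: 'k::field \<Rightarrow> 'k free_alg"
proof
  fix a b :: 'k and f :: "'k free_alg"
  show "free_const (a + b) = free_const a + free_const b"
    by (simp add: free_const_def single_add)
  show "free_const (a * b) = free_const a * free_const b"
    by (simp add: free_const_def mult_single)
  show "free_const 1 = (1 :: 'k free_alg)"
    by (simp add: free_const_def)
  show "free_const a * f = f * free_const a"
    by (induction f rule: free_alg_induct_single)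
      (simp_all add: free_const_def mult_single distrib_left distrib_right mult.commute)
qed

text \<open>
  The character of the free algebra that sends \<open>x\<close> to \<open>\<alpha>\<close> and \<open>y\<close> to \<open>0\<close>.
\<close>

definition eval_at :: "'k::field \<Rightarrow> 'k free_alg \<Rightarrow> 'k" where
  "eval_at \<alpha> f = (\<Sum>w\<in>Poly_Mapping.keys f. Poly_Mapping.lookup f w *
     (\<Prod>g\<leftarrow>letters w. case g of GenX \<Rightarrow> \<alpha> | GenY \<Rightarrow> 0))"

lemma eval_at_single:
  "eval_at \<alpha> (Poly_Mapping.single w a) = a * (\<Prod>g\<leftarrow>letters w. case g of GenX \<Rightarrow> \<alpha> | GenY \<Rightarrow> 0)"
  by (simp add: eval_at_def)

lemma eval_at_add: "eval_at \<alpha> (f + g) = eval_at \<alpha> f + eval_at \<alpha> g"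
  unfolding eval_at_def by (rule setsum_keys_plus_distrib) (simp_all add: distrib_right)

lemma eval_at_mult: "eval_at \<alpha> (f * g) = eval_at \<alpha> f * eval_at \<alpha> g"
proof (induction f rule: free_alg_induct_single)
  case (single w a)
  show ?case
    by (induction g rule: free_alg_induct_single)
      (simp_all add: mult_single eval_at_single plus_word_def eval_at_add distrib_left)
qed (simp add: distrib_right eval_at_add)

lemma eval_at_const: "eval_at \<alpha> (free_const a) = a"
  by (simp add: free_const_def eval_at_single zero_word_def)

lemma eval_at_gen: "eval_at \<alpha> (free_gen g) = (case g of GenX \<Rightarrow> \<alpha> | GenY \<Rightarrow> 0)"
  by (simp add: free_gen_def eval_at_single)

lemma eval_at_0: "eval_at \<alpha> 0 = 0" by (simp add: eval_at_def)

lemma eval_at_uminus: "eval_at \<alpha> (- f) = - eval_at \<alpha> f"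
  using eval_at_add[of \<alpha> f "- f"] by (simp add: eval_at_0 eq_neg_iff_add_eq_0 add.commute)

lemma eval_at_diff: "eval_at \<alpha> (f - g) = eval_at \<alpha> f - eval_at \<alpha> g"
  using eval_at_add[of \<alpha> f "- g"] by (simp add: eval_at_uminus)


section \<open>The quotient algebra\<close>

lemma ring_of_type_algebra_sel [simp]:
  "carrier ring_of_type_algebra = UNIV"
  "a \<oplus>\<^bsub>ring_of_type_algebra\<^esub> b = a + b"
  "a \<otimes>\<^bsub>ring_of_type_algebra\<^esub> b = a * b"
  "\<one>\<^bsub>ring_of_type_algebra\<^esub> = 1"
  "\<zero>\<^bsub>ring_of_type_algebra\<^esub> = 0"
  by (simp_all add: ring_of_type_algebra_def)

interpretation free_ring: ring "ring_of_type_algebra :: 'k::field free_alg ring"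
proof -
  have "\<exists>g. f + g = 0" for f :: "'k free_alg" by (rule exI[of _ "- f"]) simp
  then show "ring (ring_of_type_algebra :: 'k free_alg ring)"
    unfolding ring_of_type_algebra_def
    by unfold_locales (auto simp: algebra_simps Units_def)
qed

lemma ring_of_type_algebra_uminus [simp]:
  "\<ominus>\<^bsub>ring_of_type_algebra\<^esub> (f :: 'k::field free_alg) = - f"
  by (rule free_ring.minus_equality) simp_all

lemma ring_of_type_algebra_minus [simp]:
  "(f :: 'k::field free_alg) \<ominus>\<^bsub>ring_of_type_algebra\<^esub> g = f - g"
  by (simp add: a_minus_def)

lemma ideal_jordan_ideal: "ideal (jordan_ideal :: 'k::field free_alg set) ring_of_type_algebra"
  unfolding jordan_ideal_def by (rule free_ring.genideal_ideal) simp

interpretation jordan: ring "jordan_plane :: 'k::field free_alg set ring"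
  unfolding jordan_plane_def by (rule ideal.quotient_is_ring[OF ideal_jordan_ideal])

lemma jordan_class_hom: "jordan_class \<in> ring_hom ring_of_type_algebra jordan_plane"
proof -
  have "jordan_class = (+>\<^bsub>ring_of_type_algebra\<^esub>) jordan_ideal"
    by (rule ext) (simp add: jordan_class_def)
  then show ?thesis
    unfolding jordan_plane_def using ideal.rcos_ring_hom[OF ideal_jordan_ideal] by metis
qed

lemma jordan_class_closed [simp]: "jordan_class f \<in> carrier jordan_plane"
  using ring_hom_closed[OF jordan_class_hom, of f] by simp

lemma jordan_class_add: "jordan_class (f + g) = jordan_class f \<oplus>\<^bsub>jordan_plane\<^esub> jordan_class g"
  using ring_hom_add[OF jordan_class_hom, of f g] by simp

lemma jordan_class_mult: "jordan_class (f * g) = jordan_class f \<otimes>\<^bsub>jordan_plane\<^esub> jordan_class g"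
  using ring_hom_mult[OF jordan_class_hom, of f g] by simp

lemma jordan_class_1: "jordan_class 1 = \<one>\<^bsub>jordan_plane\<^esub>"
  using ring_hom_one[OF jordan_class_hom] by simp

lemma jordan_class_0: "jordan_class 0 = \<zero>\<^bsub>jordan_plane\<^esub>"
  using ring_hom_zero[OF jordan_class_hom free_ring.ring_axioms jordan.ring_axioms] by simp

lemma jordan_class_uminus: "jordan_class (- f) = \<ominus>\<^bsub>jordan_plane\<^esub> jordan_class f"
proof -
  have "jordan_class (- f) \<oplus>\<^bsub>jordan_plane\<^esub> jordan_class f = \<zero>\<^bsub>jordan_plane\<^esub>"
    by (simp flip: jordan_class_add jordan_class_0)
  then show ?thesis by (intro jordan.minus_equality[symmetric]) auto
qed

lemma jordan_class_diff: "jordan_class (f - g) = jordan_class f \<ominus>\<^bsub>jordan_plane\<^esub> jordan_class g"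
  using jordan_class_add[of f "- g"] by (simp add: jordan_class_uminus a_minus_def)

lemma carrier_jordan_plane: "carrier jordan_plane = range jordan_class"
  by (auto simp: jordan_plane_def jordan_class_def FactRing_def A_RCOSETS_def')

lemma jordan_class_eq_iff: "jordan_class f = jordan_class g \<longleftrightarrow> f - g \<in> jordan_ideal"
  using free_ring.quotient_eq_iff_same_a_r_cos[OF ideal_jordan_ideal, of f g]
  by (simp add: jordan_class_def)

lemma jordan_relation:
  "jordan_class (free_gen GenX * free_gen GenY - free_gen GenY * free_gen GenX
          - free_gen GenY * free_gen GenY :: 'k::field free_alg) = \<zero>\<^bsub>jordan_plane\<^esub>"
  unfolding jordan_class_0[symmetric] jordan_class_eq_iff
  unfolding jordan_ideal_def using free_ring.genideal_self' by simp


section \<open>Modules over a ring\<close>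

lemma left_submodule_memD:
  assumes "submodule N R M"
  shows "N \<subseteq> carrier M" "\<zero>\<^bsub>M\<^esub> \<in> N"
proof -
  interpret submodule N R M by fact
  show "N \<subseteq> carrier M" "\<zero>\<^bsub>M\<^esub> \<in> N" using subset one_closed by auto
qed

text \<open>
  Closure under additive inverses comes from multiplication by \<open>-1\<close>.
\<close>

lemma (in ring) idealI_no_inverse:
  assumes "I \<subseteq> carrier R" "\<zero> \<in> I" "\<And>a b. a \<in> I \<Longrightarrow> b \<in> I \<Longrightarrow> a \<oplus> b \<in> I"
    and l: "\<And>a r. a \<in> I \<Longrightarrow> r \<in> carrier R \<Longrightarrow> r \<otimes> a \<in> I"
    and r: "\<And>a r. a \<in> I \<Longrightarrow> r \<in> carrier R \<Longrightarrow> a \<otimes> r \<in> I"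
  shows "ideal I R"
proof (rule idealI[OF ring_axioms _ l r])
  have "\<ominus> a \<in> I" if "a \<in> I" for a
    using l[OF that, of "\<ominus> \<one>"] assms(1) that by (auto simp: l_minus)
  then show "subgroup I (add_monoid R)"
    using assms(1-3) by (intro subgroup.intro) (auto simp: a_inv_def)
qed

context left_module
begin

lemma smult_zero_right: "a \<in> carrier R \<Longrightarrow> a \<odot>\<^bsub>M\<^esub> \<zero>\<^bsub>M\<^esub> = \<zero>\<^bsub>M\<^esub>"
  using smult_r_distr[of a "\<zero>\<^bsub>M\<^esub>" "\<zero>\<^bsub>M\<^esub>"] smult_closed[of a "\<zero>\<^bsub>M\<^esub>"] M.l_neg
  by (metis M.add.r_cancel_one' M.l_zero M.zero_closed)

lemma smult_zero_left: "m \<in> carrier M \<Longrightarrow> \<zero> \<odot>\<^bsub>M\<^esub> m = \<zero>\<^bsub>M\<^esub>"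
  using smult_l_distr[of \<zero> \<zero> m] smult_closed[of \<zero> m]
  by (metis M.add.r_cancel_one' R.l_zero R.zero_closed)

lemma smult_uminus_left:
  assumes "a \<in> carrier R" "m \<in> carrier M"
  shows "(\<ominus> a) \<odot>\<^bsub>M\<^esub> m = \<ominus>\<^bsub>M\<^esub> (a \<odot>\<^bsub>M\<^esub> m)"
proof -
  have "(\<ominus> a) \<odot>\<^bsub>M\<^esub> m \<oplus>\<^bsub>M\<^esub> a \<odot>\<^bsub>M\<^esub> m = \<zero>\<^bsub>M\<^esub>"
    using assms by (simp flip: smult_l_distr add: R.l_neg smult_zero_left)
  then show ?thesis
    using assms by (intro M.minus_equality[symmetric]) (auto intro: smult_closed)
qed

lemma smult_finsum:
  assumes "finite B" "a \<in> carrier R" "h \<in> B \<rightarrow> carrier M"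
  shows "a \<odot>\<^bsub>M\<^esub> finsum M h B = finsum M (\<lambda>b. a \<odot>\<^bsub>M\<^esub> h b) B"
  using assms(1,3)
proof (induction B rule: finite_induct)
  case empty
  show ?case using assms(2) by (simp add: smult_zero_right)
next
  case (insert b B)
  then have "(\<lambda>b. a \<odot>\<^bsub>M\<^esub> h b) \<in> B \<rightarrow> carrier M" "a \<odot>\<^bsub>M\<^esub> h b \<in> carrier M"
    using assms(2) by (auto intro: smult_closed)
  with insert show ?case
    using assms(2) by (simp add: smult_r_distr Pi_def)
qed

lemma left_submoduleI:
  assumes "N \<subseteq> carrier M" "\<zero>\<^bsub>M\<^esub> \<in> N"
    and "\<And>m n. m \<in> N \<Longrightarrow> n \<in> N \<Longrightarrow> m \<oplus>\<^bsub>M\<^esub> n \<in> N"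
    and smult: "\<And>a m. a \<in> carrier R \<Longrightarrow> m \<in> N \<Longrightarrow> a \<odot>\<^bsub>M\<^esub> m \<in> N"
  shows "submodule N R M"
proof -
  have "\<ominus>\<^bsub>M\<^esub> m \<in> N" if "m \<in> N" for m
    using smult[OF _ that, of "\<ominus> \<one>"] smult_uminus_left[of \<one> m] smult_one[of m] assms(1) that
    by auto
  then show ?thesis
    using assms by (intro submodule.intro subgroup.intro) (auto simp: submodule_axioms_def a_inv_def)
qed

lemma module_annihilator_ideal: "ideal (module_annihilator R M) R"
  by (rule R.idealI_no_inverse)
    (auto simp: module_annihilator_def smult_l_distr smult_zero_left smult_assoc smult_closed
      smult_zero_right)

lemma one_notin_module_annihilator:
  assumes "carrier M \<noteq> {\<zero>\<^bsub>M\<^esub>}"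
  shows "\<one> \<notin> module_annihilator R M"
  using assms M.zero_closed by (auto simp: module_annihilator_def smult_one)

end

text \<open>
  The quotient of a ring by a two-sided ideal as a left module.  Its elements are sets of ring
  elements, which is the carrier type over which primitive ideals are defined.
\<close>

definition quotient_module :: "('r, 'c) ring_scheme \<Rightarrow> 'r set \<Rightarrow> ('r, 'r set) module" where
  "quotient_module R I = ring.extend (R Quot I)
     (module.fields (\<lambda>r m. (I +>\<^bsub>R\<^esub> r) \<otimes>\<^bsub>R Quot I\<^esub> m))"

lemma quotient_module_sel [simp]:
  "carrier (quotient_module R I) = carrier (R Quot I)"
  "m \<oplus>\<^bsub>quotient_module R I\<^esub> n = m \<oplus>\<^bsub>R Quot I\<^esub> n"
  "\<zero>\<^bsub>quotient_module R I\<^esub> = \<zero>\<^bsub>R Quot I\<^esub>"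
  "r \<odot>\<^bsub>quotient_module R I\<^esub> m = (I +>\<^bsub>R\<^esub> r) \<otimes>\<^bsub>R Quot I\<^esub> m"
  by (simp_all add: quotient_module_def ring.defs module.defs)

context ideal
begin

lemma left_module_quotient_module: "left_module R (quotient_module R I)"
proof -
  interpret Q: ring "R Quot I" by (rule quotient_is_ring)
  interpret h: ring_hom_ring R "R Quot I" "(+>) I" by (rule rcos_ring_hom_ring)
  have "abelian_group (quotient_module R I)"
  proof (rule abelian_groupI)
    fix m assume "m \<in> carrier (quotient_module R I)"
    then show "\<exists>n\<in>carrier (quotient_module R I).
        n \<oplus>\<^bsub>quotient_module R I\<^esub> m = \<zero>\<^bsub>quotient_module R I\<^esub>"
      using Q.l_neg[of m] Q.a_inv_closed[of m] by auto
  qed (simp_all add: Q.a_ac)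
  then show ?thesis
    by (intro left_module.intro left_module_axioms.intro)
      (simp_all add: ring_axioms Q.l_distr Q.r_distr Q.m_assoc)
qed

text \<open>
  An element that annihilates the quotient annihilates the coset of \<open>1\<close>, hence lies in \<open>I\<close>; the
  converse needs that \<open>I\<close> is two-sided.
\<close>

lemma annihilator_quotient_module: "module_annihilator R (quotient_module R I) = I"
proof -
  interpret Q: ring "R Quot I" by (rule quotient_is_ring)
  interpret h: ring_hom_ring R "R Quot I" "(+>) I" by (rule rcos_ring_hom_ring)
  have zero: "\<zero>\<^bsub>R Quot I\<^esub> = I" by (simp only: FactRing_def ring.simps)
  have "(\<forall>m\<in>carrier (R Quot I). (I +> r) \<otimes>\<^bsub>R Quot I\<^esub> m = \<zero>\<^bsub>R Quot I\<^esub>) \<longleftrightarrow> r \<in> I"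
    if r: "r \<in> carrier R" for r
  proof
    assume "\<forall>m\<in>carrier (R Quot I). (I +> r) \<otimes>\<^bsub>R Quot I\<^esub> m = \<zero>\<^bsub>R Quot I\<^esub>"
    then have "I +> r = I"
      using bspec[OF _ Q.one_closed] Q.r_one[OF h.hom_closed[OF r]] zero by fastforce
    then show "r \<in> I" by (rule rcos_const_imp_mem[OF r])
  next
    assume "r \<in> I"
    then have "I +> r = \<zero>\<^bsub>R Quot I\<^esub>" unfolding zero by (rule a_rcos_const)
    then show "\<forall>m\<in>carrier (R Quot I). (I +> r) \<otimes>\<^bsub>R Quot I\<^esub> m = \<zero>\<^bsub>R Quot I\<^esub>"
      by simp
  qed
  then show ?thesis
    using a_subset by (auto simp: module_annihilator_def)
qed

end


section \<open>Finite-dimensional simple modules over the Jordan plane\<close>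

locale jordan_module = left_module jordan_plane M
  for M :: "('k::{alg_closed_field, field_char_0} free_alg set, 'm) module" (structure)
begin

definition act :: "'k free_alg \<Rightarrow> 'm \<Rightarrow> 'm" where
  "act f m = jordan_class f \<odot> m"

lemma act_closed [simp]: "m \<in> carrier M \<Longrightarrow> act f m \<in> carrier M"
  by (simp add: act_def smult_closed)

lemma act_add: "m \<in> carrier M \<Longrightarrow> act (f + g) m = act f m \<oplus> act g m"
  by (simp add: act_def jordan_class_add smult_l_distr)

lemma act_mult: "m \<in> carrier M \<Longrightarrow> act (f * g) m = act f (act g m)"
  by (simp add: act_def jordan_class_mult smult_assoc)

lemma act_1: "m \<in> carrier M \<Longrightarrow> act 1 m = m"
  by (simp add: act_def jordan_class_1 smult_one)

lemma act_0: "m \<in> carrier M \<Longrightarrow> act 0 m = \<zero>"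
  by (simp add: act_def jordan_class_0 smult_zero_left)

lemma act_zero_right [simp]: "act f \<zero> = \<zero>"
  by (simp add: act_def smult_zero_right)

lemma act_add_right:
  "m \<in> carrier M \<Longrightarrow> n \<in> carrier M \<Longrightarrow> act f (m \<oplus> n) = act f m \<oplus> act f n"
  by (simp add: act_def smult_r_distr)

lemma act_relation:
  "m \<in> carrier M \<Longrightarrow> act (free_gen GenX * free_gen GenY - free_gen GenY * free_gen GenX
      - free_gen GenY * free_gen GenY) m = \<zero>"
  unfolding act_def jordan_relation by (rule smult_zero_left)

lemma left_ideal_annihilator:
  "v \<in> carrier M \<Longrightarrow> free.left_ideal {f. act f v = \<zero>}"
  by (simp add: free.left_ideal_def act_0 act_add act_mult)

text \<open>
  A linear relation between coordinate vectors with respect to \<open>B\<close> thus becomes a relation between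
  the vectors themselves, whichever coordinates are chosen.
\<close>

lemma act_linear_combination:
  assumes "finite B" "B \<subseteq> carrier M" "v \<in> carrier M" "finite I"
    and "\<And>i. i \<in> I \<Longrightarrow> act (f i) v = finsum M (\<lambda>b. act (free_const (c i b)) b) B"
  shows "act (\<Sum>i\<in>I. free_const (a i) * f i) v =
      finsum M (\<lambda>b. act (free_const (\<Sum>i\<in>I. a i * c i b)) b) B"
  using assms(4,5)
proof (induction I rule: finite_induct)
  case empty
  have "finsum M (\<lambda>b. act 0 b) B = finsum M (\<lambda>b. \<zero>) B"
    using assms(2) by (intro M.finsum_cong') (auto simp: act_0)
  then show ?case using assms(3) by (simp add: free.scalar_0 act_0)
next
  case (insert i I)
  have "act (free_const (a i)) (act (f i) v) =
      finsum M (\<lambda>b. act (free_const (a i)) (act (free_const (c i b)) b)) B"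
    unfolding insert.prems[OF insertI1] using assms(1,2)
    by (simp add: act_def smult_finsum Pi_def subset_iff smult_closed)
  also have "\<dots> = finsum M (\<lambda>b. act (free_const (a i * c i b)) b) B"
    using assms(2) by (intro M.finsum_cong') (auto simp: free.scalar_mult act_mult)
  finally have "act (\<Sum>i\<in>insert i I. free_const (a i) * f i) v =
      finsum M (\<lambda>b. act (free_const (a i * c i b)) b) B \<oplus>
      finsum M (\<lambda>b. act (free_const (\<Sum>i\<in>I. a i * c i b)) b) B"
    using insert assms(3) by (simp add: act_add act_mult)
  also have "\<dots> = finsum M (\<lambda>b. act (free_const (a i * c i b)) b \<oplus>
      act (free_const (\<Sum>i\<in>I. a i * c i b)) b) B"
    using assms(2) by (intro M.finsum_addf[symmetric]) auto
  also have "\<dots> = finsum M (\<lambda>b. act (free_const (\<Sum>i\<in>insert i I. a i * c i b)) b) B"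
    using assms(2) insert.hyps
    by (intro M.finsum_cong') (auto simp: free.scalar_add act_add)
  finally show ?case .
qed

text \<open>
  Any \<open>card B + 1\<close> vectors of a module spanned by \<open>B\<close> are dependent, because their coordinate
  vectors are.
\<close>

lemma finite_codimension_annihilator:
  assumes "finite_dimensional_module jordan_const M" "v \<in> carrier M"
  shows "free.finite_codimension {f. act f v = \<zero>}"
proof -
  obtain B where B: "finite B" "B \<subseteq> carrier M"
    "\<And>m. m \<in> carrier M \<Longrightarrow> \<exists>c. m = finsum M (\<lambda>b. jordan_const (c b) \<odot> b) B"
    using assms(1) unfolding finite_dimensional_module_def by blast
  have "\<exists>a. (\<exists>i\<le>card B. a i \<noteq> 0) \<and> act (\<Sum>i\<le>card B. free_const (a i) * f i) v = \<zero>"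
    for f :: "nat \<Rightarrow> 'k free_alg"
  proof -
    have "\<forall>i. \<exists>c. act (f i) v = finsum M (\<lambda>b. act (free_const (c b)) b) B"
      unfolding act_def[of "free_const _"] using B(3) assms(2) by simp
    then obtain c where c: "\<And>i. act (f i) v = finsum M (\<lambda>b. act (free_const (c i b)) b) B"
      by metis
    obtain a where a: "\<exists>i\<le>card B. a i \<noteq> 0" "\<And>b. b \<in> B \<Longrightarrow> (\<Sum>i\<le>card B. a i * c i b) = 0"
      using nontrivial_linear_relation[OF B(1), of "{..card B}" c] by auto
    have "act (\<Sum>i\<le>card B. free_const (a i) * f i) v =
        finsum M (\<lambda>b. act (free_const (\<Sum>i\<le>card B. a i * c i b)) b) B"
      using c by (intro act_linear_combination B assms(2)) auto
    also have "\<dots> = finsum M (\<lambda>b. \<zero>) B"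
      using B(2) a(2) by (intro M.finsum_cong') (auto simp: free.scalar_0 act_0)
    finally show ?thesis using a(1) by auto
  qed
  then show ?thesis unfolding free.finite_codimension_def by blast
qed

text \<open>
  Schur's lemma for one operator: if the kernel of \<open>T\<close> is stable under both generators, it is a
  submodule, and then simplicity leaves only the case \<open>T = 0\<close> once the kernel is nonzero.
\<close>

lemma kernel_stable_imp_zero_on_simple:
  assumes simple: "simple_left_module jordan_plane M"
    and stable: "\<And>g m. m \<in> carrier M \<Longrightarrow> act T m = \<zero> \<Longrightarrow> act T (act (free_gen g) m) = \<zero>"
    and w: "w \<in> carrier M" "w \<noteq> \<zero>" "act T w = \<zero>"
    and m: "m \<in> carrier M"
  shows "act T m = \<zero>"
proof -
  define N where "N = {m \<in> carrier M. act T m = \<zero>}"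
  have "act T (act f m) = \<zero>" if "m \<in> N" for f m
    using that
  proof (induction f rule: free_alg_induct)
    case (const a)
    then show ?case
      by (simp add: N_def act_mult[symmetric] free.scalar_central[symmetric])
        (simp add: act_mult)
  next
    case (gen g f)
    then show ?case using stable[of "act f m" g] by (simp add: N_def act_mult)
  next
    case (add f g)
    then show ?case by (simp add: N_def act_add act_add_right)
  qed
  then have "submodule N jordan_plane M"
    by (intro left_submoduleI)
      (auto simp: N_def act_add_right carrier_jordan_plane act_def[symmetric])
  moreover have "N \<noteq> {\<zero>}" using w by (auto simp: N_def)
  ultimately have "N = carrier M"
    using simple unfolding simple_left_module_def by blast
  then show ?thesis using m by (auto simp: N_def)
qed

lemma y_acts_as_zero_on_simple:
  assumes "simple_left_module jordan_plane M" "finite_dimensional_module jordan_const M"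
    and m: "m \<in> carrier M"
  shows "act (free_gen GenY) m = \<zero>"
proof -
  obtain v where v: "v \<in> carrier M" "v \<noteq> \<zero>"
    using assms(1) M.zero_closed unfolding simple_left_module_def by blast
  obtain g where g: "act g v \<noteq> \<zero>" "act (free_gen GenY * g) v = \<zero>"
    using y_has_kernel[OF free.central_scalars_axioms left_ideal_annihilator[OF v(1)]
        finite_codimension_annihilator[OF assms(2) v(1)], of "free_gen GenX" "free_gen GenY"]
      v by (auto simp: act_1 act_mult[of v "_ - _"] act_relation)
  show ?thesis
  proof (rule kernel_stable_imp_zero_on_simple[OF assms(1)])
    show "act g v \<in> carrier M" "act g v \<noteq> \<zero>" "act (free_gen GenY) (act g v) = \<zero>"
      using g v by (auto simp: act_mult)
  next
    fix h m
    assume m: "m \<in> carrier M" "act (free_gen GenY) m = \<zero>"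
    show "act (free_gen GenY) (act (free_gen h) m) = \<zero>"
    proof (cases h)
      case GenX
      let ?x = "free_gen GenX :: 'k free_alg" and ?y = "free_gen GenY :: 'k free_alg"
      \<comment> \<open>Adding the defining relation to \<open>yx\<close> gives \<open>(x - y)y\<close>.\<close>
      have "act (?y * ?x + (?x * ?y - ?y * ?x - ?y * ?y)) m = act ((?x - ?y) * ?y) m"
        by (rule arg_cong[where f = "\<lambda>f. act f m"]) (simp add: algebra_simps)
      then show ?thesis
        using m act_relation[OF m(1)] GenX
        by (simp only: act_add act_mult) simp
    qed (use m in simp)
  qed fact
qed

text \<open>
  As \<open>y\<close> acts as zero, every generator maps an eigenspace of \<open>x\<close> into itself.
\<close>

lemma x_acts_as_scalar_on_simple:
  assumes "simple_left_module jordan_plane M" "finite_dimensional_module jordan_const M"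
  obtains \<alpha> where "\<And>m. m \<in> carrier M \<Longrightarrow> act (free_gen GenX - free_const \<alpha>) m = \<zero>"
proof -
  obtain v where v: "v \<in> carrier M" "v \<noteq> \<zero>"
    using assms(1) M.zero_closed unfolding simple_left_module_def by blast
  obtain g \<alpha> where g: "act g v \<noteq> \<zero>" "act ((free_gen GenX - free_const \<alpha>) * g) v = \<zero>"
    using free.eigenvector_exists[OF alg_closed_imp_poly_has_root left_ideal_annihilator[OF v(1)]
        finite_codimension_annihilator[OF assms(2) v(1)], of "free_gen GenX"]
      v by (auto simp: act_1)
  let ?T = "free_gen GenX - free_const \<alpha> :: 'k free_alg"
  have "act ?T m = \<zero>" if "m \<in> carrier M" for m
  proof (rule kernel_stable_imp_zero_on_simple[OF assms(1) _ _ _ _ that])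
    show "act g v \<in> carrier M" "act g v \<noteq> \<zero>" "act ?T (act g v) = \<zero>"
      using g v by (auto simp: act_mult)
  next
    fix h m
    assume m: "m \<in> carrier M" "act ?T m = \<zero>"
    show "act ?T (act (free_gen h) m) = \<zero>"
    proof (cases h)
      case GenX
      have "?T * free_gen GenX = free_gen GenX * ?T"
        by (simp add: algebra_simps free.scalar_central)
      then show ?thesis using m GenX by (simp add: act_mult[symmetric]) (simp add: act_mult)
    next
      case GenY
      then show ?thesis using m y_acts_as_zero_on_simple[OF assms m(1)] by simp
    qed
  qed
  then show thesis by (rule that)
qed

end


section \<open>Primitive ideals\<close>

definition point_ideal :: "'k::field \<Rightarrow> 'k free_alg set set" where
  "point_ideal \<alpha> = genideal jordan_plane {jordan_y, jordan_x \<ominus>\<^bsub>jordan_plane\<^esub> jordan_const \<alpha>}"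

lemma ideal_point_ideal: "ideal (point_ideal \<alpha>) jordan_plane"
  unfolding point_ideal_def by (rule jordan.genideal_ideal) simp

lemma point_ideal_gens:
  "jordan_y \<in> point_ideal \<alpha>" "jordan_class (free_gen GenX - free_const \<alpha>) \<in> point_ideal \<alpha>"
  using jordan.genideal_self[of "{jordan_y, jordan_x \<ominus>\<^bsub>jordan_plane\<^esub> jordan_const \<alpha>}"]
  by (auto simp: point_ideal_def jordan_class_diff)

lemma point_ideal_minimal:
  assumes "ideal P jordan_plane" "jordan_y \<in> P" "jordan_class (free_gen GenX - free_const \<alpha>) \<in> P"
  shows "point_ideal \<alpha> \<subseteq> P"
  unfolding point_ideal_def using assms
  by (intro jordan.genideal_minimal) (auto simp: jordan_class_diff)

text \<open>
  The quotient by \<open>id(y, x - \<alpha>)\<close> is spanned by \<open>1\<close>: a factor \<open>x\<close> may be replaced by \<open>\<alpha>\<close>,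
  and a product that begins with \<open>y\<close> vanishes.
\<close>

lemma scalar_mod_point_ideal:
  "\<exists>c. jordan_class (f - free_const c) \<in> point_ideal \<alpha>"
proof -
  interpret I: ideal "point_ideal \<alpha>" jordan_plane by (rule ideal_point_ideal)
  have lmult: "jordan_class (h * f) \<in> point_ideal \<alpha>" if "jordan_class f \<in> point_ideal \<alpha>" for f h
    using that I.I_l_closed by (simp add: jordan_class_mult)
  have rmult: "jordan_class (f * h) \<in> point_ideal \<alpha>" if "jordan_class f \<in> point_ideal \<alpha>" for f h
    using that I.I_r_closed by (simp add: jordan_class_mult)
  have sum_closed: "jordan_class (f + g) \<in> point_ideal \<alpha>"
    if "jordan_class f \<in> point_ideal \<alpha>" "jordan_class g \<in> point_ideal \<alpha>" for f g
    using that I.a_closed by (simp add: jordan_class_add)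
  show ?thesis
  proof (induction f rule: free_alg_induct)
    case (const a)
    show ?case by (rule exI[of _ a]) (simp add: jordan_class_0)
  next
    case (gen g f)
    then obtain c where c: "jordan_class (f - free_const c) \<in> point_ideal \<alpha>" by blast
    show ?case
    proof (cases g)
      case GenX
      have "free_gen g * f - free_const (\<alpha> * c) = free_gen g * (f - free_const c) +
          (free_gen GenX - free_const \<alpha>) * free_const c"
        by (simp add: GenX free.scalar_mult algebra_simps)
      then show ?thesis using sum_closed[OF lmult[OF c] rmult[OF point_ideal_gens(2)]] by metis
    next
      case GenY
      then show ?thesis
        using rmult[OF point_ideal_gens(1), of f] by (intro exI[of _ 0]) (simp add: free.scalar_0)
    qed
  next
    case (add f g)
    then obtain c d where
      "jordan_class (f - free_const c) \<in> point_ideal \<alpha>"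
      "jordan_class (g - free_const d) \<in> point_ideal \<alpha>" by blast
    moreover have "f + g - free_const (c + d) = (f - free_const c) + (g - free_const d)"
      by (simp add: free.scalar_add)
    ultimately show ?case using sum_closed by metis
  qed
qed

text \<open>
  The character of the free algebra at \<open>(\<alpha>, 0)\<close> respects the relation, because both \<open>xy - yx\<close> and
  \<open>y\<^sup>2\<close> go to \<open>0\<close>.  Its kernel therefore gives an ideal of the Jordan plane that contains
  \<open>id(y, x - \<alpha>)\<close> but not \<open>1\<close>.
\<close>

lemma one_notin_point_ideal: "\<one>\<^bsub>jordan_plane\<^esub> \<notin> point_ideal \<alpha>"
proof
  let ?K = "jordan_class ` {f. eval_at \<alpha> f = 0}"
  assume "\<one>\<^bsub>jordan_plane\<^esub> \<in> point_ideal \<alpha>"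
  have ker: "ideal {f. eval_at \<alpha> f = 0} ring_of_type_algebra"
    by (rule free_ring.idealI_no_inverse) (auto simp: eval_at_add eval_at_mult eval_at_0)
  have J: "jordan_ideal \<subseteq> {f. eval_at \<alpha> f = 0}"
    unfolding jordan_ideal_def
    by (intro free_ring.genideal_minimal ker) (simp add: eval_at_diff eval_at_mult eval_at_gen)
  have "ideal ?K jordan_plane"
    by (rule jordan.idealI_no_inverse)
      (auto simp: carrier_jordan_plane eval_at_0 eval_at_add eval_at_mult
        simp flip: jordan_class_add jordan_class_mult jordan_class_0)
  then have "point_ideal \<alpha> \<subseteq> ?K"
    by (rule point_ideal_minimal) (auto simp: eval_at_gen eval_at_diff eval_at_const)
  then obtain f where f: "jordan_class 1 = jordan_class f" "eval_at \<alpha> f = 0"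
    using \<open>\<one>\<^bsub>jordan_plane\<^esub> \<in> point_ideal \<alpha>\<close> by (auto simp: jordan_class_1)
  then have "eval_at \<alpha> (1 - f) = 0" using J by (auto simp: jordan_class_eq_iff)
  then show False using f(2) eval_at_const[of \<alpha> 1] by (simp add: eval_at_diff free.scalar_1)
qed

text \<open>
  An element of \<open>P\<close> is a scalar modulo \<open>id(y, x - \<alpha>)\<close>; this scalar lies in \<open>P\<close> as well and is
  zero, since otherwise it would be a unit.
\<close>

lemma point_ideal_maximal:
  assumes P: "ideal P jordan_plane" "point_ideal \<alpha> \<subseteq> P" "\<one>\<^bsub>jordan_plane\<^esub> \<notin> P"
  shows "P = point_ideal \<alpha>"
proof (rule antisym)
  interpret P: ideal P jordan_plane by fact
  show "P \<subseteq> point_ideal \<alpha>"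
  proof
    fix r assume r: "r \<in> P"
    then obtain f where f: "r = jordan_class f" using P.Icarr carrier_jordan_plane by blast
    obtain c where c: "jordan_class (f - free_const c) \<in> point_ideal \<alpha>"
      using scalar_mod_point_ideal by blast
    have "jordan_class (free_const c) = r \<ominus>\<^bsub>jordan_plane\<^esub> jordan_class (f - free_const c)"
      unfolding f by (simp flip: jordan_class_diff)
    then have cP: "jordan_class (free_const c) \<in> P"
      using r c P(2) by (auto simp: a_minus_def)
    have "c = 0"
    proof (rule ccontr)
      assume "c \<noteq> 0"
      then have "jordan_class (free_const (inverse c) * free_const c) = \<one>\<^bsub>jordan_plane\<^esub>"
        by (simp flip: free.scalar_mult add: free.scalar_1 jordan_class_1)
      moreover have "jordan_class (free_const (inverse c) * free_const c) \<in> P"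
        using cP P.I_l_closed by (simp add: jordan_class_mult)
      ultimately show False using P(3) by simp
    qed
    then show "r \<in> point_ideal \<alpha>" using c f by (simp add: free.scalar_0)
  qed
qed fact

lemma fd_primitive_ideal_imp_point_ideal:
  fixes P :: "'k::{alg_closed_field, field_char_0} free_alg set set"
  assumes "fd_primitive_ideal jordan_const jordan_plane P"
  shows "\<exists>\<alpha>. P = point_ideal \<alpha>"
proof -
  obtain M :: "('k free_alg set, 'k free_alg set set) module" where
    M: "simple_left_module jordan_plane M" "finite_dimensional_module jordan_const M"
    and P: "P = module_annihilator jordan_plane M"
    using assms unfolding fd_primitive_ideal_def by blast
  interpret jordan_module M
    using M(1) by (simp add: jordan_module_def simple_left_module_def)
  obtain \<alpha> where \<alpha>: "\<And>m. m \<in> carrier M \<Longrightarrow> act (free_gen GenX - free_const \<alpha>) m = \<zero>\<^bsub>M\<^esub>"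
    using x_acts_as_scalar_on_simple[OF M] by blast
  have "point_ideal \<alpha> \<subseteq> P"
    unfolding P using \<alpha> y_acts_as_zero_on_simple[OF M]
    by (intro point_ideal_minimal module_annihilator_ideal)
      (auto simp: module_annihilator_def act_def)
  then have "P = point_ideal \<alpha>"
    using M(1) unfolding P simple_left_module_def
    by (intro point_ideal_maximal module_annihilator_ideal one_notin_module_annihilator) auto
  then show ?thesis ..
qed

text \<open>
  The quotient by \<open>id(y, x - \<alpha>)\<close> is a module of dimension one, as its elements are the cosets of
  scalars and it is not zero.  This makes it simple, and its annihilator is the ideal itself.
\<close>

lemma point_ideal_fd_primitive:
  "fd_primitive_ideal jordan_const jordan_plane (point_ideal \<alpha>)"
proof -
  let ?I = "point_ideal \<alpha>" and ?M = "quotient_module jordan_plane (point_ideal \<alpha>)"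
  let ?q = "\<lambda>f. ?I +>\<^bsub>jordan_plane\<^esub> jordan_class f"
  interpret I: ideal ?I jordan_plane by (rule ideal_point_ideal)
  interpret h: ring_hom_ring jordan_plane "jordan_plane Quot ?I" "(+>\<^bsub>jordan_plane\<^esub>) ?I"
    by (rule I.rcos_ring_hom_ring)
  interpret M: left_module jordan_plane ?M by (rule I.left_module_quotient_module)
  have q_closed: "?q f \<in> carrier ?M" for f by (simp del: quotient_module_sel(2-))
  have carrier: "carrier ?M = range (\<lambda>c. ?q (free_const c))"
  proof
    show "range (\<lambda>c. ?q (free_const c)) \<subseteq> carrier ?M" using q_closed by blast
    show "carrier ?M \<subseteq> range (\<lambda>c. ?q (free_const c))"
    proof
      fix m assume "m \<in> carrier ?M"
      then have "m \<in> (\<Union>r\<in>range jordan_class. {?I +>\<^bsub>jordan_plane\<^esub> r})"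
        by (simp only: quotient_module_sel FactRing_def partial_object.simps A_RCOSETS_def'
            carrier_jordan_plane)
      then obtain f where f: "m = ?q f" by blast
      obtain c where "jordan_class (f - free_const c) \<in> ?I" using scalar_mod_point_ideal by blast
      then have "m = ?q (free_const c)"
        unfolding f jordan_class_diff
        using jordan.quotient_eq_iff_same_a_r_cos[OF ideal_point_ideal, of "jordan_class f"
            "jordan_const c"] by (meson jordan_class_closed)
      then show "m \<in> range (\<lambda>c. ?q (free_const c))" by blast
    qed
  qed
  have act: "jordan_class f \<odot>\<^bsub>?M\<^esub> ?q g = ?q (f * g)" for f g
    by (simp add: jordan_class_mult)
  have zero: "\<zero>\<^bsub>?M\<^esub> = ?q (free_const 0)"
    using h.hom_zero by (simp add: free.scalar_0 jordan_class_0)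
  have "simple_left_module jordan_plane ?M"
    unfolding simple_left_module_def
  proof (intro conjI allI impI)
    show "left_module jordan_plane ?M" by (rule M.left_module_axioms)
    show "carrier ?M \<noteq> {\<zero>\<^bsub>?M\<^esub>}"
      using I.annihilator_quotient_module one_notin_point_ideal[of \<alpha>]
      by (auto simp: module_annihilator_def M.smult_one)
  next
    fix N assume N: "submodule N jordan_plane ?M"
    have sub: "N \<subseteq> carrier ?M" and "\<zero>\<^bsub>?M\<^esub> \<in> N"
      using left_submodule_memD[OF N] by blast+
    have "carrier ?M \<subseteq> N" if nz: "N \<noteq> {\<zero>\<^bsub>?M\<^esub>}"
    proof -
      obtain n where n: "n \<in> N" "n \<noteq> \<zero>\<^bsub>?M\<^esub>" using nz \<open>\<zero>\<^bsub>?M\<^esub> \<in> N\<close> by blast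
      then obtain c where c: "n = ?q (free_const c)" using sub carrier by blast
      then have "c \<noteq> 0" using n(2) zero by blast
      have "?q (free_const d) \<in> N" for d
      proof -
        have "free_const (d / c) * free_const c = free_const d"
          using \<open>c \<noteq> 0\<close> by (simp flip: free.scalar_mult)
        then have "?q (free_const d) = jordan_const (d / c) \<odot>\<^bsub>?M\<^esub> n"
          unfolding c act by (simp only:)
        also have "\<dots> \<in> N"
          by (rule submodule.smult_closed[OF N jordan_class_closed n(1)])
        finally show ?thesis .
      qed
      then show ?thesis unfolding carrier by blast
    qed
    then show "N = {\<zero>\<^bsub>?M\<^esub>} \<or> N = carrier ?M" using sub by blast
  qed
  moreover have "finite_dimensional_module jordan_const ?M"
    unfolding finite_dimensional_module_def
  proof (intro exI[of _ "{?q 1}"] conjI ballI)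
    show "{?q 1} \<subseteq> carrier ?M" using q_closed by blast
    fix m assume "m \<in> carrier ?M"
    then obtain c where m: "m = ?q (free_const c)" using carrier by blast
    have "finsum ?M (\<lambda>b. jordan_const c \<odot>\<^bsub>?M\<^esub> b) {?q 1} = jordan_const c \<odot>\<^bsub>?M\<^esub> ?q 1"
      using M.smult_closed[OF jordan_class_closed q_closed]
      by (subst M.M.finsum_insert) (simp_all del: quotient_module_sel)
    then show "\<exists>c. m = finsum ?M (\<lambda>b. jordan_const (c b) \<odot>\<^bsub>?M\<^esub> b) {?q 1}"
      unfolding act m by (intro exI[of _ "\<lambda>_. c"]) simp
  qed simp
  ultimately show ?thesis
    unfolding fd_primitive_ideal_def using I.annihilator_quotient_module by metis
qed

theorem corollary4:
  shows "{P. fd_primitive_ideal jordan_const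
               (jordan_plane :: 'k::{alg_closed_field, field_char_0} free_alg set ring) P} =
         {genideal jordan_plane {jordan_y, jordan_x \<ominus>\<^bsub>jordan_plane\<^esub> jordan_const \<alpha>} | \<alpha>. True}"
  using fd_primitive_ideal_imp_point_ideal point_ideal_fd_primitive
  unfolding point_ideal_def by blast

end
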